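(* Let $n \ge 2$ and let $S_n$ be the star on $n$ vertices. Then $l(-(K_1 \vee S_n)) = 1$, while $l_{\max}(K_1 \vee S_n) = \left\lfloor \frac{n}{2} \right\rfloor$.
   Context: All graphs are finite, simple and undirected. A signed graph $\Sigma=(G,\sigma)$ is a graph $G$ with a signature $\sigma:E(G)\to\{+1,-1\}$. The sign of a cycle is the product of the signs of its edges; $\Sigma$ is balanced if all its cycles are positive. The frustration index $l(\Sigma)$ is the minimum number of edges whose deletion makes $\Sigma$ balanced. $-G$ is $G$ with all edges signed $-1$. $l_{\max}(G)=\max_\sigma l(G,\sigma)$ over all signatures of $G$. $G_1\vee G_2$ denotes the join of vertex-disjoint graphs. The star $S_n$ on $n$ vertices is the tree $K_{1,n-1}$. *)

theory Defs
  imports Complex_Main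
begin

datatype 'a graph = Graph (verts: "'a set") (edges: "'a set set")

definition simple_graph :: "'a graph \<Rightarrow> bool" where
  "simple_graph G \<longleftrightarrow>
     finite (verts G) \<and> (\<forall>e \<in> edges G. e \<subseteq> verts G \<and> card e = 2)"

definition is_complete_graph :: "nat \<Rightarrow> 'a graph \<Rightarrow> bool" where
  "is_complete_graph n G \<longleftrightarrow>
     simple_graph G \<and> card (verts G) = n \<and>
     edges G = {{u, v} |u v. u \<in> verts G \<and> v \<in> verts G \<and> u \<noteq> v}"

definition is_complete_bipartite :: "nat \<Rightarrow> nat \<Rightarrow> 'a graph \<Rightarrow> bool" where
  "is_complete_bipartite m n G \<longleftrightarrow>
     simple_graph G \<and>
     (\<exists>A B. verts G = A \<union> B \<and> A \<inter> B = {} \<and> card A = m \<and> card B = n \<and>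
        edges G = {{a, b} |a b. a \<in> A \<and> b \<in> B})"

definition is_star :: "nat \<Rightarrow> 'a graph \<Rightarrow> bool" where
  "is_star n G \<longleftrightarrow> n \<ge> 1 \<and> is_complete_bipartite 1 (n - 1) G"

text \<open>The graph join is only meaningful for graphs with disjoint vertex sets.\<close>

definition join :: "'a graph \<Rightarrow> 'a graph \<Rightarrow> 'a graph" where
  "join G H = Graph (verts G \<union> verts H)
     (edges G \<union> edges H \<union> {{u, v} |u v. u \<in> verts G \<and> v \<in> verts H})"

definition delete_edges :: "'a graph \<Rightarrow> 'a set set \<Rightarrow> 'a graph" where
  "delete_edges G F = Graph (verts G) (edges G - F)"

text \<open>A cycle is given by the list of its vertices in cyclic order; its \<open>i\<close>-th edge joins
  the \<open>i\<close>-th vertex to the next one, the last vertex being followed by the first.\<close>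

definition cycle_edge :: "'a list \<Rightarrow> nat \<Rightarrow> 'a set" where
  "cycle_edge xs i = {xs ! i, xs ! (Suc i mod length xs)}"

definition is_cycle :: "'a graph \<Rightarrow> 'a list \<Rightarrow> bool" where
  "is_cycle G xs \<longleftrightarrow>
     length xs \<ge> 3 \<and> distinct xs \<and> set xs \<subseteq> verts G \<and>
     (\<forall>i < length xs. cycle_edge xs i \<in> edges G)"

text \<open>A signed graph is a graph \<open>G\<close> together with a signature of \<open>G\<close>; the values of a
  signature outside \<open>edges G\<close> are irrelevant.\<close>

definition is_signature :: "'a graph \<Rightarrow> ('a set \<Rightarrow> int) \<Rightarrow> bool" where
  "is_signature G \<sigma> \<longleftrightarrow> (\<forall>e \<in> edges G. \<sigma> e \<in> {1, -1})"

definition all_negative :: "'a set \<Rightarrow> int" where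
  "all_negative = (\<lambda>e. -1)"

definition cycle_sign :: "('a set \<Rightarrow> int) \<Rightarrow> 'a list \<Rightarrow> int" where
  "cycle_sign \<sigma> xs = (\<Prod>i < length xs. \<sigma> (cycle_edge xs i))"

definition balanced :: "'a graph \<Rightarrow> ('a set \<Rightarrow> int) \<Rightarrow> bool" where
  "balanced G \<sigma> \<longleftrightarrow> (\<forall>xs. is_cycle G xs \<longrightarrow> cycle_sign \<sigma> xs = 1)"

text \<open>For a finite graph both sets below are finite and nonempty: deleting all edges leaves
  no cycle, and the frustration index is at most the number of edges.\<close>

definition frustration_index :: "'a graph \<Rightarrow> ('a set \<Rightarrow> int) \<Rightarrow> nat" where
  "frustration_index G \<sigma> =
     Min {card F |F. F \<subseteq> edges G \<and> balanced (delete_edges G F) \<sigma>}"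

definition max_frustration_index :: "'a graph \<Rightarrow> nat" where
  "max_frustration_index G = Max {frustration_index G \<sigma> |\<sigma>. is_signature G \<sigma>}"

end

theory Submission
  imports Defs
begin

text \<open>The graph \<open>K\<^sub>1 \<or> S\<^sub>n\<close> is a book: \<open>n - 1\<close> triangles sharing the edge (spine) that joins the
  vertex of \<open>K\<^sub>1\<close> to the centre of the star. If \<open>a\<close> of the triangles are negative, it suffices to
  delete one edge of each of them, or the spine and one edge of each of the \<open>n - 1 - a\<close> positive
  triangles. This is optimal: if the spine is kept, every negative triangle must lose another
  edge; if it is deleted, a negative and a positive triangle that both lose no other edge form
  a negative 4-cycle. Hence the frustration index is \<open>min a (n - a)\<close>.\<close>

text \<open>Each vertex of a cycle lies on exactly two of its edges, so its potential enters the
  cycle sign squared. Exhibiting such a \<open>p\<close> replaces any inspection of cycles when a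
  deletion set is to be shown sufficient.\<close>

lemma balanced_if_potential:
  assumes p: "\<And>v. p v \<in> {1, -1}"
    and e: "\<And>u v. {u, v} \<in> edges G \<Longrightarrow> \<sigma> {u, v} = p u * p v"
  shows "balanced G \<sigma>"
  unfolding balanced_def
proof (intro allI impI)
  fix xs assume "is_cycle G xs"
  then obtain m where m: "length xs = Suc m"
    and c: "\<And>i. i < length xs \<Longrightarrow> cycle_edge xs i \<in> edges G"
    by (cases "length xs") (auto simp: is_cycle_def)
  have "cycle_sign \<sigma> xs = (\<Prod>i<Suc m. p (xs ! i) * p (xs ! (Suc i mod Suc m)))"
    unfolding cycle_sign_def m using c e by (intro prod.cong) (auto simp: cycle_edge_def m)
  also have "\<dots> = (\<Prod>i<Suc m. p (xs ! i)) * (\<Prod>i<Suc m. p (xs ! (Suc i mod Suc m)))"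
    by (rule prod.distrib)
  \<comment> \<open>Only the factor at \<open>i = m\<close> wraps around, to index 0; the shift by
    one in the next step then recovers the product over all vertices.\<close>
  also have "(\<Prod>i<Suc m. p (xs ! (Suc i mod Suc m))) = (\<Prod>i<m. p (xs ! Suc i)) * p (xs ! 0)"
    by simp
  also have "\<dots> = (\<Prod>i<Suc m. p (xs ! i))"
    by (simp only: prod.lessThan_Suc_shift mult.commute)
  also have "(\<Prod>i<Suc m. p (xs ! i)) * (\<Prod>i<Suc m. p (xs ! i)) = (\<Prod>i<Suc m. p (xs ! i) * p (xs ! i))"
    by (rule prod.distrib [symmetric])
  also have "\<dots> = 1"
    using p by (intro prod.neutral) (metis insertE minus_one_mult_self mult_1 mult_minus_left
      minus_minus empty_iff)
  finally show "cycle_sign \<sigma> xs = 1" .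
qed

lemma frustration_index_eqI:
  assumes "finite (edges G)" "F \<subseteq> edges G" "balanced (delete_edges G F) \<sigma>"
    and "\<And>F'. F' \<subseteq> edges G \<Longrightarrow> balanced (delete_edges G F') \<sigma> \<Longrightarrow> card F \<le> card F'"
  shows "frustration_index G \<sigma> = card F"
  unfolding frustration_index_def
proof (rule Min_eqI)
  have "{card F |F. F \<subseteq> edges G \<and> balanced (delete_edges G F) \<sigma>} \<subseteq> card ` Pow (edges G)"
    by auto
  with \<open>finite (edges G)\<close> show "finite {card F |F. F \<subseteq> edges G \<and> balanced (delete_edges G F) \<sigma>}"
    by (meson finite_Pow_iff finite_imageI finite_subset)
qed (use assms in auto)

text \<open>This isolates the shape of the join: \<open>k\<close> stands for the vertex of
  \<open>K\<^sub>1\<close>, \<open>c\<close> for the centre of the star, \<open>L\<close> for its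
  leaves. The spine is \<open>{k, c}\<close>, and each \<open>l\<close> in \<open>L\<close> gives
  one triangular page.\<close>

locale book =
  fixes k c :: 'a and L :: "'a set" and G :: "'a graph"
  assumes finite_L: "finite L" and k_ne_c: "k \<noteq> c" and k_notin_L: "k \<notin> L" and c_notin_L: "c \<notin> L"
    and verts_eq: "verts G = insert k (insert c L)"
    and edges_eq: "edges G = insert {k, c} ((\<lambda>l. {k, l}) ` L \<union> (\<lambda>l. {c, l}) ` L)"
begin

lemma finite_edges: "finite (edges G)"
  using finite_L by (simp add: edges_eq)

definition negative_pages :: "('a set \<Rightarrow> int) \<Rightarrow> 'a set" where
  "negative_pages \<sigma> = {l \<in> L. \<sigma> {k, c} * \<sigma> {k, l} * \<sigma> {c, l} = -1}"

lemma negative_pages_subset: "negative_pages \<sigma> \<subseteq> L"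
  by (auto simp: negative_pages_def)

lemma signature_values:
  assumes "is_signature G \<sigma>"
  shows "\<sigma> {k, c} \<in> {1, -1}" and "l \<in> L \<Longrightarrow> \<sigma> {k, l} \<in> {1, -1}" and "l \<in> L \<Longrightarrow> \<sigma> {c, l} \<in> {1, -1}"
  using assms by (auto simp: is_signature_def edges_eq)

text \<open>The vertex \<open>k\<close> gets potential 1, its neighbours \<open>l \<in> L\<close> get \<open>\<sigma> {k, l}\<close>, and \<open>c\<close> gets \<open>s\<close>;
  the deleted edges are those on which \<open>\<sigma>\<close> disagrees with this potential.\<close>

lemma balanced_delete_disagreements:
  assumes \<sigma>: "is_signature G \<sigma>" and s: "s \<in> {1, -1}"
    and spine: "\<sigma> {k, c} \<noteq> s \<Longrightarrow> {k, c} \<in> F"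
    and pages: "\<And>l. l \<in> L \<Longrightarrow> \<sigma> {c, l} \<noteq> s * \<sigma> {k, l} \<Longrightarrow> {c, l} \<in> F"
  shows "balanced (delete_edges G F) \<sigma>"
proof (rule balanced_if_potential)
  let ?p = "\<lambda>v. if v = c then s else if v \<in> L then \<sigma> {k, v} else 1"
  show "?p v \<in> {1, -1}" for v
    using s signature_values(2)[OF \<sigma>] by auto
  fix u v assume "{u, v} \<in> edges (delete_edges G F)"
  then have "{u, v} \<notin> F" "{u, v} \<in> edges G"
    by (auto simp: delete_edges_def)
  then consider "{u, v} = {k, c}" | l where "l \<in> L" "{u, v} = {k, l}" | l where "l \<in> L" "{u, v} = {c, l}"
    by (auto simp: edges_eq)
  then show "\<sigma> {u, v} = ?p u * ?p v"
  proof cases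
    case 1
    then have "\<sigma> {u, v} = s" using spine \<open>{u, v} \<notin> F\<close> by metis
    with 1 show ?thesis using k_ne_c k_notin_L by (auto simp: doubleton_eq_iff)
  next
    case 2
    then show ?thesis using k_ne_c k_notin_L c_notin_L by (auto simp: doubleton_eq_iff insert_commute)
  next
    case 3
    then have "\<sigma> {u, v} = s * \<sigma> {k, l}" using pages \<open>{u, v} \<notin> F\<close> by metis
    with 3 show ?thesis using c_notin_L by (auto simp: doubleton_eq_iff insert_commute)
  qed
qed

lemma negative_triangle_hit:
  assumes "balanced (delete_edges G F) \<sigma>" "{k, c} \<notin> F" "l \<in> negative_pages \<sigma>"
  shows "{k, l} \<in> F \<or> {c, l} \<in> F"
proof (rule ccontr)
  assume "\<not> ?thesis"
  moreover have l: "l \<in> L" "\<sigma> {k, c} * \<sigma> {k, l} * \<sigma> {c, l} = -1"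
    using assms(3) unfolding negative_pages_def by blast+
  ultimately have "is_cycle (delete_edges G F) [k, c, l]"
    using assms(2) k_ne_c k_notin_L c_notin_L
    by (auto simp: is_cycle_def delete_edges_def cycle_edge_def verts_eq edges_eq All_less_Suc insert_commute)
  moreover have "cycle_sign \<sigma> [k, c, l] = \<sigma> {k, c} * \<sigma> {k, l} * \<sigma> {c, l}"
    by (simp add: cycle_sign_def cycle_edge_def insert_commute lessThan_Suc)
  ultimately show False using assms(1) l(2) by (auto simp: balanced_def)
qed

text \<open>The 4-cycle through \<open>k\<close>, \<open>l\<close>, \<open>c\<close>,
  \<open>l'\<close> avoids the spine. Its sign is the product of the signs of the two triangles,
  since the sign of the spine cancels as a square, and is therefore negative.\<close>

lemma opposite_pages_hit:
  assumes "balanced (delete_edges G F) \<sigma>" and \<sigma>: "is_signature G \<sigma>"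
    and "l \<in> negative_pages \<sigma>" "l' \<in> L - negative_pages \<sigma>"
  shows "{k, l} \<in> F \<or> {c, l} \<in> F \<or> {k, l'} \<in> F \<or> {c, l'} \<in> F"
proof (rule ccontr)
  assume "\<not> ?thesis"
  moreover have l: "l \<in> L" "l' \<in> L" "l \<noteq> l'"
    and sgn: "\<sigma> {k, c} * \<sigma> {k, l} * \<sigma> {c, l} = -1" "\<sigma> {k, c} * \<sigma> {k, l'} * \<sigma> {c, l'} \<noteq> -1"
    using assms(3,4) unfolding negative_pages_def by blast+
  ultimately have "is_cycle (delete_edges G F) [k, l, c, l']"
    using k_ne_c k_notin_L c_notin_L
    by (auto simp: is_cycle_def delete_edges_def cycle_edge_def verts_eq edges_eq All_less_Suc insert_commute)
  then have "cycle_sign \<sigma> [k, l, c, l'] = 1"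
    using assms(1) by (simp add: balanced_def)
  moreover have "cycle_sign \<sigma> [k, l, c, l'] = \<sigma> {k, l} * \<sigma> {c, l} * \<sigma> {k, l'} * \<sigma> {c, l'}"
    by (simp add: cycle_sign_def cycle_edge_def insert_commute lessThan_Suc)
  ultimately show False
    using sgn signature_values[OF \<sigma>] l by auto
qed

text \<open>Distinct pages share no edge other than the spine, so choosing one deleted edge per page
  is injective and never selects the spine. The set \<open>M\<close> is left general because it is
  later either the negative or the positive pages.\<close>

lemma card_hit_pages_le:
  assumes "M \<subseteq> L" "finite F" and hit: "\<And>l. l \<in> M \<Longrightarrow> {k, l} \<in> F \<or> {c, l} \<in> F"
  shows "card M \<le> card (F - {{k, c}})"
proof (rule card_inj_on_le)
  let ?g = "\<lambda>l. if {k, l} \<in> F then {k, l} else {c, l}"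
  show "inj_on ?g M"
    using assms(1) k_notin_L c_notin_L by (auto simp: inj_on_def doubleton_eq_iff split: if_splits)
  show "?g ` M \<subseteq> F - {{k, c}}"
    using assms(1) hit k_notin_L c_notin_L by (auto simp: doubleton_eq_iff)
qed (use assms in simp)

lemma card_deleted_ge:
  assumes \<sigma>: "is_signature G \<sigma>" and F: "F \<subseteq> edges G" and bal: "balanced (delete_edges G F) \<sigma>"
  shows "min (card (negative_pages \<sigma>)) (Suc (card (L - negative_pages \<sigma>))) \<le> card F"
proof -
  have fin: "finite F" using F finite_edges by (rule finite_subset)
  show ?thesis
  proof (cases "{k, c} \<in> F")
    case False
    then have "card (negative_pages \<sigma>) \<le> card (F - {{k, c}})"
      using card_hit_pages_le[OF negative_pages_subset fin] negative_triangle_hit[OF bal] by blast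
    with False show ?thesis by simp
  next
    case True
    \<comment> \<open>A negative and a positive page cannot both avoid \<open>F\<close> outside the
      spine, so all pages of one of the two signs are hit.\<close>
    consider "\<And>l. l \<in> negative_pages \<sigma> \<Longrightarrow> {k, l} \<in> F \<or> {c, l} \<in> F"
      | "\<And>l. l \<in> L - negative_pages \<sigma> \<Longrightarrow> {k, l} \<in> F \<or> {c, l} \<in> F"
      using opposite_pages_hit[OF bal \<sigma>] by blast
    then have "min (card (negative_pages \<sigma>)) (card (L - negative_pages \<sigma>)) \<le> card (F - {{k, c}})"
    proof cases
      case 1
      then show ?thesis using card_hit_pages_le[OF negative_pages_subset fin] by (simp add: min.coboundedI1)
    next
      case 2
      then show ?thesis using card_hit_pages_le[OF Diff_subset fin] by (simp add: min.coboundedI2)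
    qed
    \<comment> \<open>The spine adds one to the bound just obtained, which is more than enough if
      the negative pages attain the minimum and exactly enough otherwise.\<close>
    moreover have "card F = Suc (card (F - {{k, c}}))"
      using fin True by (rule card.remove)
    ultimately show ?thesis by linarith
  qed
qed

lemma frustration_index_book:
  assumes \<sigma>: "is_signature G \<sigma>"
  shows "frustration_index G \<sigma> = min (card (negative_pages \<sigma>)) (Suc (card (L - negative_pages \<sigma>)))"
    (is "_ = min (card ?N) (Suc (card ?P))")
proof -
  have inj: "inj_on (\<lambda>l. {c, l}) A" for A
    by (auto simp: inj_on_def doubleton_eq_iff)
  note vals = signature_values[OF \<sigma>]
  \<comment> \<open>Giving \<open>c\<close> the potential \<open>\<sigma> {k, c}\<close> makes the
    spine agree, and the disagreeing edges are those from \<open>c\<close> into the negative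
    pages.\<close>
  define F where "F = (\<lambda>l. {c, l}) ` ?N"
  have F: "F \<subseteq> edges G" "card F = card ?N"
    using negative_pages_subset by (auto simp: F_def edges_eq card_image[OF inj])
  have F_bal: "balanced (delete_edges G F) \<sigma>"
  proof (rule balanced_delete_disagreements[OF \<sigma> vals(1)])
    fix l assume "l \<in> L" "\<sigma> {c, l} \<noteq> \<sigma> {k, c} * \<sigma> {k, l}"
    with vals(1) vals(2,3)[OF \<open>l \<in> L\<close>] show "{c, l} \<in> F"
      by (auto simp: F_def negative_pages_def)
  qed simp
  \<comment> \<open>With the opposite potential at \<open>c\<close> the spine disagrees, and the
    roles of negative and positive pages are exchanged.\<close>
  define F' where "F' = insert {k, c} ((\<lambda>l. {c, l}) ` ?P)"
  have F': "F' \<subseteq> edges G" "card F' = Suc (card ?P)"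
    using finite_L k_notin_L k_ne_c by (auto simp: F'_def edges_eq card_image[OF inj] card_insert_if doubleton_eq_iff)
  have F'_bal: "balanced (delete_edges G F') \<sigma>"
  proof (rule balanced_delete_disagreements[OF \<sigma>, of "- \<sigma> {k, c}"])
    fix l assume "l \<in> L" "\<sigma> {c, l} \<noteq> - \<sigma> {k, c} * \<sigma> {k, l}"
    with vals(1) vals(2,3)[OF \<open>l \<in> L\<close>] show "{c, l} \<in> F'"
      by (auto simp: F'_def negative_pages_def)
  qed (use vals(1) in \<open>auto simp: F'_def\<close>)
  note ge = card_deleted_ge[OF \<sigma>]
  show ?thesis
  proof (cases "card ?N \<le> Suc (card ?P)")
    case True
    with ge have "frustration_index G \<sigma> = card F"
      by (intro frustration_index_eqI finite_edges F F_bal) (simp add: F)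
    with True F show ?thesis by simp
  next
    case False
    with ge have "frustration_index G \<sigma> = card F'"
      by (intro frustration_index_eqI finite_edges F' F'_bal) (simp add: F')
    with False F' show ?thesis by simp
  qed
qed

lemma negative_pages_all_negative: "negative_pages all_negative = L"
  by (simp add: negative_pages_def all_negative_def)

lemma frustration_index_all_negative:
  assumes "L \<noteq> {}"
  shows "frustration_index G all_negative = 1"
proof -
  \<comment> \<open>All pages are negative here, so the general formula reads
    \<open>min (card L) 1\<close>.\<close>
  have "card L \<ge> 1" using assms finite_L by (simp add: Suc_le_eq card_gt_0_iff)
  moreover have "is_signature G all_negative" by (simp add: is_signature_def all_negative_def)
  ultimately show ?thesis by (simp add: frustration_index_book negative_pages_all_negative)
qed

lemma ex_signature_negative_pages:
  assumes "A \<subseteq> L"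
  shows "\<exists>\<sigma>. is_signature G \<sigma> \<and> negative_pages \<sigma> = A"
proof (intro exI conjI)
  \<comment> \<open>Each edge \<open>{c, l}\<close> lies in a single page, so negating it changes
    the sign of that page alone.\<close>
  let ?\<sigma> = "\<lambda>e. if e \<in> (\<lambda>l. {c, l}) ` A then -1 else 1 :: int"
  show "is_signature G ?\<sigma>" by (simp add: is_signature_def)
  show "negative_pages ?\<sigma> = A"
    using assms k_ne_c k_notin_L c_notin_L
    by (auto simp: negative_pages_def image_iff doubleton_eq_iff)
qed

text \<open>With \<open>n = Suc (card L)\<close> and \<open>a\<close> negative pages the index is
  \<open>min a (n - a)\<close>. This never exceeds \<open>n div 2\<close>, and equals it at
  \<open>a = n div 2\<close>.\<close>

lemma max_frustration_index_book:
  assumes "L \<noteq> {}"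
  shows "max_frustration_index G = Suc (card L) div 2"
  unfolding max_frustration_index_def
proof (rule Max_eqI)
  let ?S = "{frustration_index G \<sigma> |\<sigma>. is_signature G \<sigma>}"
  have card_P: "card (L - negative_pages \<sigma>) = card L - card (negative_pages \<sigma>)"
    and card_N: "card (negative_pages \<sigma>) \<le> card L" for \<sigma>
    using negative_pages_subset finite_L
    by (auto intro: card_Diff_subset card_mono finite_subset)
  show le: "y \<le> Suc (card L) div 2" if "y \<in> ?S" for y
  proof -
    from that obtain \<sigma> where "is_signature G \<sigma>" "y = frustration_index G \<sigma>" by blast
    then show ?thesis using card_P[of \<sigma>] card_N[of \<sigma>] by (auto simp: frustration_index_book)
  qed
  \<comment> \<open>There are infinitely many functions \<open>\<sigma>\<close>, as values off the
    edges are free; finiteness comes from the bound on the indices instead.\<close>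
  then show "finite ?S" by (meson finite_nat_set_iff_bounded_le)
  have "card L \<ge> 1" using assms finite_L by (simp add: Suc_le_eq card_gt_0_iff)
  then have "Suc (card L) div 2 \<le> card L" by linarith
  then obtain A where "A \<subseteq> L" "card A = Suc (card L) div 2"
    by (meson obtain_subset_with_card_n)
  then obtain \<sigma> where \<sigma>: "is_signature G \<sigma>" "card (negative_pages \<sigma>) = Suc (card L) div 2"
    using ex_signature_negative_pages by metis
  then have "frustration_index G \<sigma> = Suc (card L) div 2"
    using card_P[of \<sigma>] by (simp add: frustration_index_book)
  with \<sigma>(1) show "Suc (card L) div 2 \<in> ?S" by (metis (mono_tags, lifting) mem_Collect_eq)
qed

end

text \<open>The singleton side of the bipartition supplies \<open>c\<close> and the other side
  \<open>L\<close>. The star contributes the edges \<open>{c, l}\<close>; joining with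
  \<open>k\<close> adds the spine and the edges \<open>{k, l}\<close>.\<close>

lemma join_complete_graph_1_star_book:
  assumes "is_complete_graph 1 K" "is_star n S" "verts K \<inter> verts S = {}"
  obtains k c L where "book k c L (join K S)" "card L = n - 1"
proof -
  obtain k where K: "verts K = {k}" "edges K = {}"
    using assms(1) by (auto simp: is_complete_graph_def card_1_singleton_iff)
  obtain A L where "verts S = A \<union> L" "A \<inter> L = {}" "card A = 1" "card L = n - 1"
    "edges S = {{a, b} |a b. a \<in> A \<and> b \<in> L}" "finite (verts S)"
    using assms(2) by (auto simp: is_star_def is_complete_bipartite_def simple_graph_def)
  moreover from this obtain c where "A = {c}" by (auto simp: card_1_singleton_iff)
  ultimately have "book k c L (join K S)" "card L = n - 1"
    using K assms(3) by (unfold_locales; auto simp: join_def)+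
  then show thesis by (rule that)
qed

theorem corollary13:
  fixes n :: nat and K S :: "'a graph"
  assumes "n \<ge> 2"
    and "is_complete_graph 1 K"
    and "is_star n S"
    and "verts K \<inter> verts S = {}"
  shows "frustration_index (join K S) all_negative = 1 \<and>
    int (max_frustration_index (join K S)) = \<lfloor>real n / 2\<rfloor>"
proof -
  obtain k c L where b: "book k c L (join K S)" and L: "card L = n - 1"
    using join_complete_graph_1_star_book assms(2-4) by metis
  then have "L \<noteq> {}" "Suc (card L) = n" using assms(1) by auto
  moreover have "\<lfloor>real n / 2\<rfloor> = int (n div 2)"
    using floor_divide_of_nat_eq[of n 2] by simp
  ultimately show ?thesis
    using book.frustration_index_all_negative[OF b] book.max_frustration_index_book[OF b] by simp
qed

end
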